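(* Let $n\ge1$. For $k=0,1,\dots,n$ let $f_k$ be the column vector with coordinates indexed by $j=0,1,\dots,n$ whose $j$-th coordinate is $(-1)^{k-j}R_{n-j,k-j}$ for $j\le k$ and $0$ for $j>k$, that is, $$f_k=\bigl((-1)^kR_{n,k},\,(-1)^{k-1}R_{n-1,k-1},\,\dots,\,R_{n-k,0},\,0,\dots,0\bigr)^t.$$ Then in the basis $f_0,f_1,\dots,f_n$ the vector $(1,1,\dots,1)^t$ has coordinates $\bigl(|\mathcal{IS}_n|,|\mathcal{IS}_{n-1}|,\dots,|\mathcal{IS}_1|,|\mathcal{IS}_0|\bigr)$.
   Context: For $m\ge0$, $\mathcal{IS}_m$ is the symmetric inverse semigroup, i.e. the set of all partial injective maps from $\{1,\dots,m\}$ to itself (including the empty map); $|\mathcal{IS}_0|=1$. For $0\le k\le m$, $R_{m,k}=\binom{m}{k}^2k!$ is the number of elements of $\mathcal{IS}_m$ of rank $k$ (rank $=$ cardinality of the domain). *)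

theory Defs
  imports "Jordan_Normal_Form.VS_Connect"
begin

text \<open>Partial injective maps on \<open>{1..m}\<close>. The map is undefined (\<open>None\<close>) off its domain,
  so partial maps with the same graph are equal and \<open>card\<close> counts them correctly.\<close>

definition sym_inv_semigroup :: "nat \<Rightarrow> (nat \<rightharpoonup> nat) set" where
  "sym_inv_semigroup m = {g. dom g \<subseteq> {1..m} \<and> ran g \<subseteq> {1..m} \<and> inj_on g (dom g)}"

definition rank_num :: "nat \<Rightarrow> nat \<Rightarrow> nat" where
  "rank_num m k = (m choose k)\<^sup>2 * fact k"

definition f_vec :: "nat \<Rightarrow> nat \<Rightarrow> 'a::field_char_0 vec" where
  "f_vec n k = vec (n + 1) (\<lambda>j. if j \<le> k then (- 1) ^ (k - j) * of_nat (rank_num (n - j) (k - j)) else 0)"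

lemma card_inj_graphs:
  assumes "finite A" "finite B"
  shows "finite {g. dom g = A \<and> ran g \<subseteq> B \<and> inj_on g (dom g)}
       \<and> card {g. dom g = A \<and> ran g \<subseteq> B \<and> inj_on g (dom g)} = (card B choose card A) * fact (card A)"
  using assms
proof (induction A arbitrary: B rule: finite_induct)
  case empty
  have "{g. dom g = ({}::'a set) \<and> ran g \<subseteq> B \<and> inj_on g (dom g)} = {Map.empty}" by auto
  then show ?case by simp
next
  case (insert a A)
  let ?S = "\<lambda>A B. {g. dom g = A \<and> ran g \<subseteq> B \<and> inj_on g (dom g)}"
  have eq: "?S (insert a A) B = (\<Union>b\<in>B. (\<lambda>g. g(a \<mapsto> b)) ` ?S A (B - {b}))" (is "?L = ?U")
  proof (intro equalityI subsetI)
    fix g assume g: "g \<in> ?L"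
    then obtain b where b: "g a = Some b" by (metis (mono_tags, lifting) domD insertI1 mem_Collect_eq)
    let ?h = "g(a := None)"
    have "b \<in> B" using g b by (auto intro: ranI)
    moreover have "dom ?h = A" using g insert.hyps by auto
    moreover have "ran ?h \<subseteq> B - {b}"
    proof
      fix y assume "y \<in> ran ?h"
      then obtain x where x: "x \<noteq> a" "g x = Some y" by (auto simp: ran_def split: if_splits)
      have "y \<noteq> b" using x b g by (auto simp: inj_on_def dom_def)
      then show "y \<in> B - {b}" using g x by (auto intro: ranI)
    qed
    moreover have "inj_on ?h (dom ?h)" using g by (auto simp: inj_on_def)
    moreover have "g = ?h(a \<mapsto> b)" using b by auto
    ultimately show "g \<in> ?U" by blast
  next
    fix g assume "g \<in> ?U"
    then obtain b h where h: "b \<in> B" "h \<in> ?S A (B - {b})" "g = h(a \<mapsto> b)" by blast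
    have nb: "h x \<noteq> Some b" for x using h(2) by (auto dest: ranI)
    have "dom g = insert a A" using h by auto
    moreover have "ran g \<subseteq> B" using h by (auto simp: ran_def)
    moreover have "inj_on g (dom g)"
    proof (rule inj_onI)
      fix x y assume "x \<in> dom g" "y \<in> dom g" "g x = g y"
      then show "x = y"
        using h(2,3) nb nb[symmetric] by (auto split: if_splits dest: inj_onD)
    qed
    ultimately show "g \<in> ?L" by blast
  qed
  have inj: "inj_on (\<lambda>g. g(a \<mapsto> b)) (?S A (B - {b}))" for b
  proof (rule inj_onI)
    fix g h assume "g \<in> ?S A (B - {b})" "h \<in> ?S A (B - {b})" "g(a \<mapsto> b) = h(a \<mapsto> b)"
    moreover from this have "g a = None" "h a = None" using insert.hyps by (auto simp: domIff)
    ultimately show "g = h" by (metis fun_upd_triv fun_upd_upd)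
  qed
  have IH: "finite (?S A (B - {b})) \<and> card (?S A (B - {b})) = (card (B - {b}) choose card A) * fact (card A)" for b
    using insert.IH[of "B - {b}"] insert.prems by auto
  have "card (?S (insert a A) B) = (\<Sum>b\<in>B. card ((\<lambda>g. g(a \<mapsto> b)) ` ?S A (B - {b})))"
    unfolding eq
  proof (rule card_UN_disjoint)
    show "\<forall>b\<in>B. \<forall>c\<in>B. b \<noteq> c \<longrightarrow>
      (\<lambda>g. g(a \<mapsto> b)) ` ?S A (B - {b}) \<inter> (\<lambda>g. g(a \<mapsto> c)) ` ?S A (B - {c}) = {}"
      by (auto dest: fun_cong[where x = a])
  qed (use IH insert.prems in auto)
  also have "\<dots> = (\<Sum>b\<in>B. ((card B - 1) choose card A) * fact (card A))"
    using IH insert.prems by (intro sum.cong) (auto simp: card_image[OF inj])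
  also have "\<dots> = (card B choose card (insert a A)) * fact (card (insert a A))"
  proof (cases "card B")
    case (Suc p)
    have "Suc p * (p choose card A) * fact (card A)
        = (Suc p choose Suc (card A)) * Suc (card A) * fact (card A)"
      by (simp only: Suc_times_binomial_eq)
    then show ?thesis using Suc insert.hyps by (simp add: mult.assoc del: binomial_Suc_Suc mult_Suc)
  qed (use insert.hyps in auto)
  finally show ?case using eq IH insert.prems by auto
qed

lemma card_rank_sym_inv_semigroup:
  "card {g \<in> sym_inv_semigroup m. card (dom g) = k} = rank_num m k"
proof -
  let ?S = "\<lambda>A. {g. dom g = A \<and> ran g \<subseteq> {1..m} \<and> inj_on g (dom g)}"
  let ?P = "{A. A \<subseteq> {1..m} \<and> card A = k}"
  have eq: "{g \<in> sym_inv_semigroup m. card (dom g) = k} = (\<Union>A\<in>?P. ?S A)"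
    by (auto simp: sym_inv_semigroup_def)
  have S: "finite (?S A) \<and> card (?S A) = (m choose k) * fact k" if "A \<in> ?P" for A
    using card_inj_graphs[of A "{1..m}"] that finite_subset[of A "{1..m}"] by auto
  have "card (\<Union>A\<in>?P. ?S A) = (\<Sum>A\<in>?P. card (?S A))"
    by (rule card_UN_disjoint) (use S in auto)
  also have "\<dots> = (\<Sum>A\<in>?P. (m choose k) * fact k)" using S by (intro sum.cong) auto
  also have "\<dots> = rank_num m k" using n_subsets[of "{1..m}" k] by (simp add: rank_num_def power2_eq_square)
  finally show ?thesis using eq by simp
qed

end

theory Submission
  imports Defs
begin

text \<open>
  Write \<open>R\<close> for \<open>rank_num\<close> and \<open>IS\<close> for \<open>sym_inv_semigroup\<close>. The \<open>j\<close>-th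
  coordinate of the claimed expansion reads, with \<open>m = n - j\<close>,
  \<open>(\<Sum>i\<le>m. (-1)^i * R m i * |IS (m - i)|) = 1\<close>. A pair consisting of a rank-\<open>i\<close> choice in
  \<open>IS m\<close> and a rank-\<open>r\<close> choice in \<open>IS (m - i)\<close> amounts to a partial injection of rank
  \<open>s = i + r\<close> in which \<open>i\<close> of the \<open>s\<close> arrows are marked: the second choice lives on the
  \<open>m - i\<close> points that the marked arrows leave free on either side. Numerically this is
  \<open>R m i * R (m - i) (s - i) = (s choose i) * R m s\<close> (\<open>rank_num_mult\<close>). Splitting \<open>|IS (m - i)|\<close>
  by rank, the sum therefore counts partial injections with marked arrows, each with sign
  \<open>(-1)\<close> to the number of marks. The signs cancel for every map with at least one
  arrow, and only the empty map, which contributes \<open>1\<close>, remains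
  (\<open>alternating_sum_rank_num_card\<close>).

  That the vectors form a basis is triangularity: \<open>f_vec n k\<close> vanishes beyond coordinate \<open>k\<close>,
  where it has the entry \<open>R (n - k) 0 = 1\<close> (\<open>lower_triangular_family_basis\<close>).
\<close>

lemma rank_num_pos: "k \<le> m \<Longrightarrow> rank_num m k > 0"
  by (simp add: rank_num_def)

lemma card_sym_inv_semigroup: "card (sym_inv_semigroup m) = (\<Sum>k\<le>m. rank_num m k)"
proof -
  let ?S = "\<lambda>k. {g \<in> sym_inv_semigroup m. card (dom g) = k}"
  have "card (dom g) \<le> m" if "g \<in> sym_inv_semigroup m" for g
    using that card_mono[of "{1..m}" "dom g"] by (auto simp: sym_inv_semigroup_def)
  then have "sym_inv_semigroup m = (\<Union>k\<in>{..m}. ?S k)" by auto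
  \<comment> \<open>The strata are finite because their cardinalities are positive; \<open>card\<close> of an
    infinite set is \<open>0\<close>.\<close>
  moreover have "finite (?S k)" if "k \<le> m" for k
    using that rank_num_pos[of k m] card_rank_sym_inv_semigroup[of m k]
    by (intro card_ge_0_finite) simp
  then have "card (\<Union>k\<in>{..m}. ?S k) = (\<Sum>k\<le>m. card (?S k))"
    by (intro card_UN_disjoint) auto
  ultimately show ?thesis by (simp add: card_rank_sym_inv_semigroup)
qed

text \<open>Both sides count partial injections of rank \<open>s\<close> with \<open>i\<close> marked arrows: on the left the
  marked arrows are chosen first and the others on the remaining points, on the right all arrows are chosen and then marked.\<close>

lemma rank_num_mult:
  assumes "i \<le> s" "s \<le> m"
  shows "rank_num m i * rank_num (m - i) (s - i) = (s choose i) * rank_num m s"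
proof -
  have "rank_num m i * rank_num (m - i) (s - i)
      = ((m choose i) * ((m - i) choose (s - i)))\<^sup>2 * (fact i * fact (s - i))"
    by (simp add: rank_num_def power_mult_distrib)
  also have "\<dots> = ((m choose s) * (s choose i))\<^sup>2 * (fact i * fact (s - i))"
    using choose_mult[OF assms] by simp
  also have "\<dots> = (m choose s)\<^sup>2 * (s choose i) * (fact i * fact (s - i) * (s choose i))"
    by (simp add: power2_eq_square)
  also have "\<dots> = (s choose i) * rank_num m s"
    unfolding binomial_fact_lemma[OF assms(1)] by (simp add: rank_num_def)
  finally show ?thesis .
qed

text \<open>A map with \<open>s > 0\<close> arrows admits as many even as odd sets of marks, so in the signed count
  of marked maps only the empty map survives.\<close>

lemma alternating_sum_rank_num_card:
  "(\<Sum>i\<le>m. (-1) ^ i * of_nat (rank_num m i) * of_nat (card (sym_inv_semigroup (m - i))))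
    = (1 :: 'a::comm_ring_1)"
proof -
  let ?g = "\<lambda>i r. (-1) ^ i * of_nat (rank_num m i) * of_nat (rank_num (m - i) r) :: 'a"
  have "(\<Sum>i\<le>m. (-1) ^ i * of_nat (rank_num m i) * of_nat (card (sym_inv_semigroup (m - i))))
      = (\<Sum>i\<le>m. \<Sum>r\<le>m - i. ?g i r)"
    by (simp add: card_sym_inv_semigroup sum_distrib_left)
  also have "\<dots> = (\<Sum>(i, r)\<in>(SIGMA i:{..m}. {..m - i}). ?g i r)"
    by (simp add: sum.Sigma)
  also have "(SIGMA i:{..m}. {..m - i}) = {(i, r). i + r \<le> m}"
    by auto
  also have "(\<Sum>(i, r)\<in>\<dots>. ?g i r) = (\<Sum>s\<le>m. \<Sum>i\<le>s. ?g i (s - i))"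
    by (rule sum.triangle_reindex_eq)
  also have "\<dots> = (\<Sum>s\<le>m. of_nat (rank_num m s) * (\<Sum>i\<le>s. (-1) ^ i * of_nat (s choose i)))"
    unfolding sum_distrib_left
  proof (intro sum.cong refl)
    fix s i assume "s \<in> {..m}" "i \<in> {..s}"
    then have "of_nat (rank_num m i) * of_nat (rank_num (m - i) (s - i))
        = (of_nat (s choose i) * of_nat (rank_num m s) :: 'a)"
      by (simp only: rank_num_mult atMost_iff flip: of_nat_mult)
    then show "?g i (s - i) = of_nat (rank_num m s) * ((-1) ^ i * of_nat (s choose i))"
      by (simp only: mult.assoc) (simp only: ac_simps)
  qed
  also have "\<dots> = (\<Sum>s\<le>m. if s = 0 then 1 else 0)"
    by (intro sum.cong) (auto simp: rank_num_def choose_alternating_sum)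
  also have "\<dots> = 1" by simp
  finally show ?thesis .
qed

lemma lower_triangular_family_basis:
  fixes v :: "nat \<Rightarrow> 'a::field vec"
  assumes carrier: "\<And>k. k < n \<Longrightarrow> v k \<in> carrier_vec n"
    and diag: "\<And>k. k < n \<Longrightarrow> v k $ k \<noteq> 0"
    and above: "\<And>k j. k < j \<Longrightarrow> j < n \<Longrightarrow> v k $ j = 0"
  shows "inj_on v {..<n}"
    and "vectorspace.basis class_ring (module_vec TYPE('a) n) (v ` {..<n})"
proof -
  interpret vec_space "TYPE('a)" n .
  show inj: "inj_on v {..<n}"
  proof (rule linorder_inj_onI)
    fix k l assume "k < l" "k \<in> {..<n}" "l \<in> {..<n}"
    then show "v k \<noteq> v l" using diag[of l] above[of k l] by auto
  qed auto
  define A where "A = mat n n (\<lambda>(k, j). v k $ j)"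
  have A: "A \<in> carrier_mat n n" by (simp add: A_def)
  have row: "row A k = v k" if "k < n" for k
    using that carrier[of k] by (intro eq_vecI) (auto simp: A_def)
  have rows: "set (rows A) = v ` {..<n}"
    using A row by (auto simp: rows_def)
  have "det A = prod_list (diag_mat A)"
    by (rule det_lower_triangular[OF _ A]) (use above in \<open>auto simp: A_def\<close>)
  also have "\<dots> \<noteq> 0"
    using diag by (auto simp: prod_list_zero_iff diag_mat_def A_def)
  finally have "lin_indpt (v ` {..<n})"
    using det_not_0_imp_lin_indpt_rows[OF A] rows by simp
  then show "basis (v ` {..<n})"
    using carrier inj by (intro dim_li_is_basis) (auto simp: dim_is_n card_image)
qed

lemma f_vec_carrier: "f_vec n k \<in> carrier_vec (n + 1)"
  by (simp add: f_vec_def)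

lemma f_vec_nth:
  "j \<le> n \<Longrightarrow> f_vec n k $ j
    = (if j \<le> k then (- 1) ^ (k - j) * of_nat (rank_num (n - j) (k - j)) else 0)"
  by (simp add: f_vec_def)

text \<open>Shifting the summation index by \<open>j\<close> turns coordinate \<open>j\<close> of the combination into the
  alternating sum for \<open>m = n - j\<close>.\<close>

lemma sum_card_mult_f_vec_nth:
  assumes "j \<le> n"
  shows "(\<Sum>k\<in>{0..n}. of_nat (card (sym_inv_semigroup (n - k))) * f_vec n k $ j)
    = (1 :: 'a::field_char_0)"
proof -
  let ?h = "\<lambda>i. (-1) ^ i * of_nat (rank_num (n - j) i)
      * of_nat (card (sym_inv_semigroup (n - j - i))) :: 'a"
  have "(\<Sum>k\<in>{0..n}. of_nat (card (sym_inv_semigroup (n - k))) * (f_vec n k $ j :: 'a))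
      = (\<Sum>k\<in>{j..n}. ?h (k - j))"
    using assms by (intro sum.mono_neutral_cong_right) (auto simp: f_vec_nth)
  also have "\<dots> = (\<Sum>i\<le>n - j. ?h i)"
    by (rule sum.reindex_bij_witness[where i = "\<lambda>i. i + j" and j = "\<lambda>k. k - j"]) (use assms in auto)
  also have "\<dots> = 1" by (rule alternating_sum_rank_num_card)
  finally show ?thesis .
qed

theorem corollary11:
  fixes n :: nat
  assumes "n \<ge> 1"
  shows "inj_on (f_vec n :: nat \<Rightarrow> 'a::field_char_0 vec) {0..n}
    \<and> vectorspace.basis class_ring (module_vec TYPE('a) (n + 1)) ((f_vec n :: nat \<Rightarrow> 'a vec) ` {0..n})
    \<and> vec (n + 1) (\<lambda>_. 1 :: 'a) =
        finsum_vec TYPE('a) (n + 1)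
          (\<lambda>k. of_nat (card (sym_inv_semigroup (n - k))) \<cdot>\<^sub>v f_vec n k) {0..n}"
proof (intro conjI)
  let ?f = "f_vec n :: nat \<Rightarrow> 'a vec"
  let ?c = "\<lambda>k. of_nat (card (sym_inv_semigroup (n - k))) \<cdot>\<^sub>v ?f k"
  have range: "{0..n} = {..<n + 1}" by auto
  have diag: "?f k $ k \<noteq> 0" if "k < n + 1" for k
    using that by (simp add: f_vec_nth rank_num_def)
  have above: "?f k $ j = 0" if "k < j" "j < n + 1" for k j
    using that by (simp add: f_vec_nth)
  show "inj_on ?f {0..n}"
    unfolding range by (rule lower_triangular_family_basis(1)[OF f_vec_carrier diag above])
  show "vectorspace.basis class_ring (module_vec TYPE('a) (n + 1)) (?f ` {0..n})"
    unfolding range by (rule lower_triangular_family_basis(2)[OF f_vec_carrier diag above])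
  have c: "?c \<in> {0..n} \<rightarrow> carrier_vec (n + 1)" using f_vec_carrier by auto
  have dim: "dim_vec (finsum_vec TYPE('a) (n + 1) ?c {0..n}) = n + 1"
    using finsum_vec_closed[OF c] by (rule carrier_vecD)
  show "vec (n + 1) (\<lambda>_. 1) = finsum_vec TYPE('a) (n + 1) ?c {0..n}"
  proof (rule eq_vecI)
    fix j assume "j < dim_vec (finsum_vec TYPE('a) (n + 1) ?c {0..n})"
    then have j: "j < n + 1" by (simp only: dim)
    have "finsum_vec TYPE('a) (n + 1) ?c {0..n} $ j = (\<Sum>k\<in>{0..n}. ?c k $ j)"
      by (rule index_finsum_vec[OF _ j c]) simp
    also have "\<dots> = (\<Sum>k\<in>{0..n}. of_nat (card (sym_inv_semigroup (n - k))) * ?f k $ j)"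
      using j by (intro sum.cong) (simp_all add: f_vec_def)
    also have "\<dots> = 1"
      using j by (intro sum_card_mult_f_vec_nth) simp
    finally show "vec (n + 1) (\<lambda>_. 1) $ j = finsum_vec TYPE('a) (n + 1) ?c {0..n} $ j"
      using j by simp
  qed (simp only: dim dim_vec)
qed

end
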